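(* Condition $(\mathcal{D})$, i.e. $\pi_{X=x}(D)>0$ for $\mu$-a.e. $x\in\mathbb{R}$, implies the representation property $(\mathcal{R}_+)$.
   Context: Setting: $\mathcal{Y}$ is a separable Banach space with Borel $\sigma$-algebra $\mathcal{B}(\mathcal{Y})$, and $\pi$ is a probability measure on $\mathbb{R}\times\mathcal{Y}$ (with its Borel $\sigma$-algebra) with first marginal $\mu$ on $\mathbb{R}$ and second marginal $\nu$ on $\mathcal{Y}$. Fix probability kernels $(\pi_{X=x})_{x\in\mathbb{R}}$ (probability measures on $\mathcal{Y}$) and $(\pi_{Y=y})_{y\in\mathcal{Y}}$ (probability measures on $\mathbb{R}$) disintegrating $\pi$: $\pi(dx,dy)=\mu(dx)\,\pi_{X=x}(dy)=\nu(dy)\,\pi_{Y=y}(dx)$. $D$ is the Borel set $D=\{y\in\mathcal{Y}:\pi_{Y=y}\text{ is a Dirac mass}\}$. $L^1_+(\mu)$ denotes the set of non-negative elements of $L^1(\mu)$. Property $(\mathcal{R}_+)$: for every $f\in L^1_+(\mu)$ there exists a measurable $g:\mathcal{Y}\to\mathbb{R}_+=[0,\infty)$ such that $f(x)=\int_{\mathcal{Y}}g(y)\,\pi_{X=x}(dy)$ for $\mu$-a.e. $x$. *)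

theory Defs
  imports "HOL-Probability.Probability"
begin

definition first_marginal :: "('a::topological_space \<times> 'b::topological_space) measure \<Rightarrow> 'a measure"
  where "first_marginal P = distr P borel fst"

definition second_marginal :: "('a::topological_space \<times> 'b::topological_space) measure \<Rightarrow> 'b measure"
  where "second_marginal P = distr P borel snd"

definition prob_kernel :: "('a::topological_space \<Rightarrow> 'b::topological_space measure) \<Rightarrow> bool"
  where "prob_kernel K \<longleftrightarrow> K \<in> borel \<rightarrow>\<^sub>M prob_algebra borel"

text \<open>The law \<open>P(dx,dy)\<close> equals \<open>\<mu>(dx) K(x, dy)\<close>, with \<open>\<mu>\<close> the first marginal of \<open>P\<close>.\<close>

definition disintegrates_along_fst ::
  "('a::topological_space \<times> 'b::topological_space) measure \<Rightarrow> ('a \<Rightarrow> 'b measure) \<Rightarrow> bool"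
  where "disintegrates_along_fst P K \<longleftrightarrow>
    (\<forall>A\<in>sets borel. emeasure P A = (\<integral>\<^sup>+x. emeasure (K x) {y. (x, y) \<in> A} \<partial>first_marginal P))"

text \<open>The law \<open>P(dx,dy)\<close> equals \<open>\<nu>(dy) K(y, dx)\<close>, with \<open>\<nu>\<close> the second marginal of \<open>P\<close>.\<close>

definition disintegrates_along_snd ::
  "('a::topological_space \<times> 'b::topological_space) measure \<Rightarrow> ('b \<Rightarrow> 'a measure) \<Rightarrow> bool"
  where "disintegrates_along_snd P K \<longleftrightarrow>
    (\<forall>A\<in>sets borel. emeasure P A = (\<integral>\<^sup>+y. emeasure (K y) {x. (x, y) \<in> A} \<partial>second_marginal P))"

text \<open>For a probability kernel \<open>K\<close> into the reals this is a Borel set, so \<open>emeasure\<close> does not take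
  its default value 0 on it.\<close>

definition dirac_set :: "('b \<Rightarrow> 'a::topological_space measure) \<Rightarrow> 'b set"
  where "dirac_set K = {y. \<exists>x. K y = return borel x}"

definition condition_D ::
  "'a measure \<Rightarrow> ('a \<Rightarrow> 'b measure) \<Rightarrow> ('b \<Rightarrow> 'a::topological_space measure) \<Rightarrow> bool"
  where "condition_D \<mu> KX KY \<longleftrightarrow> (AE x in \<mu>. emeasure (KX x) (dirac_set KY) > 0)"

text \<open>Elements of \<open>L\<^sup>1\<^sub>+(\<mu>)\<close> are represented by integrable functions that are nonnegative
  \<open>\<mu>\<close>-almost everywhere. The integral of \<open>g \<ge> 0\<close> is the Lebesgue integral with values in
  \<open>[0, \<infinity>]\<close>, so that the equation with the finite value \<open>f x\<close> includes the \<open>KX x\<close>-integrability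
  of \<open>g\<close>; the Bochner integral would be 0 when \<open>g\<close> is not integrable.\<close>

definition property_R_plus ::
  "'a measure \<Rightarrow> ('a \<Rightarrow> 'b::topological_space measure) \<Rightarrow> bool"
  where "property_R_plus \<mu> KX \<longleftrightarrow>
    (\<forall>f :: 'a \<Rightarrow> real. integrable \<mu> f \<longrightarrow> (AE x in \<mu>. 0 \<le> f x) \<longrightarrow>
      (\<exists>g :: 'b \<Rightarrow> real. g \<in> borel_measurable borel \<and> (\<forall>y. 0 \<le> g y) \<and>
        (AE x in \<mu>. ennreal (f x) = (\<integral>\<^sup>+y. ennreal (g y) \<partial>KX x))))"

end

theory Submission
  imports Defs
begin

text \<open>On \<open>D\<close> write \<open>KY y\<close> as the point mass at \<open>\<phi> y\<close>. Disintegrating along \<open>y\<close> gives \<open>x = \<phi> y\<close>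
  for \<open>P\<close>-almost all \<open>(x, y)\<close> with \<open>y \<in> D\<close>; disintegrating along \<open>x\<close>, for almost every \<open>x\<close> this
  holds for \<open>KX x\<close>-almost all \<open>y \<in> D\<close>. So \<open>g y = f (\<phi> y) / KX (\<phi> y) D\<close> on \<open>D\<close>, extended by 0,
  represents \<open>f\<close>. Borel measurability of \<open>D\<close> and \<open>\<phi>\<close> comes from the first two moments of \<open>arctan\<close>
  under \<open>KY y\<close>: a law is Dirac iff \<open>arctan\<close> has variance 0, and then the atom is the tangent of
  the mean.\<close>

lemma prob_kernelD:
  assumes "prob_kernel K"
  shows "prob_space (K x)" "sets (K x) = sets borel" "K \<in> borel \<rightarrow>\<^sub>M subprob_algebra borel"
proof -
  have K: "K \<in> borel \<rightarrow>\<^sub>M prob_algebra borel"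
    using assms by (simp add: prob_kernel_def)
  then have "K x \<in> space (prob_algebra borel)"
    by (rule measurable_space) simp
  then show "prob_space (K x)" "sets (K x) = sets borel"
    by (auto simp: space_prob_algebra)
  show "K \<in> borel \<rightarrow>\<^sub>M subprob_algebra borel"
    using K by (rule measurable_prob_algebraD)
qed

text \<open>If \<open>x = a\<close> almost surely, every indicator is almost surely constant, which
  fixes the measure of every Borel set. For the converse, T1 makes the singleton of \<open>a\<close>
  Borel.\<close>

lemma eq_return_iff_AE:
  fixes M :: "'a::t1_space measure"
  assumes "prob_space M" "sets M = sets borel"
  shows "M = return borel a \<longleftrightarrow> (AE x in M. x = a)"
proof
  interpret prob_space M by fact
  assume *: "AE x in M. x = a"
  show "M = return borel a"
  proof (rule measure_eqI)
    fix A assume A: "A \<in> sets M"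
    have "emeasure M A = (\<integral>\<^sup>+x. indicator A x \<partial>M)"
      using A by simp
    also have "\<dots> = (\<integral>\<^sup>+x. indicator A a \<partial>M)"
      using * by (intro nn_integral_cong_AE) auto
    also have "\<dots> = emeasure (return borel a) A"
      using A assms(2) by (simp add: emeasure_space_1)
    finally show "emeasure M A = emeasure (return borel a) A" .
  qed (use assms in simp)
next
  assume M: "M = return borel a"
  have "Measurable.pred borel (\<lambda>x. x = a)"
    by (simp add: pred_def)
  then show "AE x in M. x = a"
    unfolding M by (subst AE_return) simp_all
qed

text \<open>A law on the line may have no finite moments; the bounded function \<open>arctan\<close>
  has all of them under every law.\<close>

lemma integrable_arctan_power:
  assumes "prob_space M" "sets M = sets borel"
  shows "integrable M (\<lambda>x. arctan x ^ n)"
proof -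
  interpret prob_space M by fact
  have [measurable]: "(\<lambda>x. arctan x ^ n) \<in> borel_measurable M"
    unfolding measurable_cong_sets[OF assms(2) refl] by measurable
  have "\<bar>arctan x\<bar> \<le> pi / 2" for x
    using arctan_bounded[of x] by auto
  then have "norm (arctan x ^ n) \<le> (pi / 2) ^ n" for x
    by (auto simp: power_abs intro!: power_mono)
  then show ?thesis
    by (intro integrable_const_bound[where B = "(pi / 2) ^ n"]) auto
qed

lemma eq_return_iff_variance_arctan:
  assumes "prob_space M" "sets M = sets borel"
  defines "c \<equiv> (LINT x|M. arctan x)"
  shows "(\<exists>a. M = return borel a) \<longleftrightarrow> (LINT x|M. (arctan x)\<^sup>2) = c\<^sup>2"
    and "M = return borel a \<Longrightarrow> a = tan c"
proof -
  interpret prob_space M by fact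
  have int: "integrable M arctan" "integrable M (\<lambda>x. (arctan x)\<^sup>2)"
    using integrable_arctan_power[OF assms(1,2), of 1] integrable_arctan_power[OF assms(1,2), of 2]
    by simp_all
  show a: "a = tan c" if "M = return borel a" for a
    unfolding c_def that by (simp add: integral_return tan_arctan)
  \<comment> \<open>Integrability is essential for the zero test below: 0 is also the default value
    of a Bochner integral that does not exist.\<close>
  have int_var: "integrable M (\<lambda>x. (arctan x - c)\<^sup>2)"
    using int by (simp add: power2_diff)
  have "(LINT x|M. (arctan x)\<^sup>2) = c\<^sup>2 \<longleftrightarrow> (LINT x|M. (arctan x - c)\<^sup>2) = 0"
    using variance_eq[OF int] by (simp add: c_def)
  also have "\<dots> \<longleftrightarrow> (AE x in M. (arctan x - c)\<^sup>2 = 0)"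
    by (rule integral_nonneg_eq_0_iff_AE[OF int_var]) simp
  also have "\<dots> \<longleftrightarrow> (AE x in M. arctan x = c)"
    by simp
  also have "\<dots> \<longleftrightarrow> (\<exists>a. M = return borel a)"
  proof
    assume "AE x in M. arctan x = c"
    then have "AE x in M. x = tan c"
      by eventually_elim (auto simp: tan_arctan)
    then show "\<exists>a. M = return borel a"
      using eq_return_iff_AE[OF assms(1,2)] by blast
  next
    assume "\<exists>a. M = return borel a"
    then obtain a where M: "M = return borel a" ..
    have "c = arctan a"
      unfolding c_def M by (simp add: integral_return)
    then show "AE x in M. arctan x = c"
      using M eq_return_iff_AE[OF assms(1,2), of a] by auto
  qed
  finally show "(\<exists>a. M = return borel a) \<longleftrightarrow> (LINT x|M. (arctan x)\<^sup>2) = c\<^sup>2" ..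
qed

text \<open>Choosing an atom for each \<open>y\<close> separately would not give a Borel map. The
  tangent of the mean is an explicit formula, defined for all \<open>y\<close> and equal to the atom
  on the Dirac set.\<close>

lemma dirac_set_atom_measurable:
  fixes K :: "'b::topological_space \<Rightarrow> real measure"
  assumes K: "prob_kernel K"
  obtains \<phi> where "\<phi> \<in> borel_measurable borel" "dirac_set K \<in> sets borel"
    "\<And>y. y \<in> dirac_set K \<Longrightarrow> K y = return borel (\<phi> y)"
proof -
  define m where "m n y = (LINT x|K y. arctan x ^ n)" for n y
  have [measurable]: "m n \<in> borel_measurable borel" for n
    unfolding m_def
    by (intro measurable_compose[OF prob_kernelD(3)[OF K] integral_measurable_subprob_algebra]) measurable
  note iff = eq_return_iff_variance_arctan[OF prob_kernelD(1,2)[OF K]]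
  have D: "dirac_set K = {y. m 2 y = (m 1 y)\<^sup>2}"
    using iff(1) by (auto simp: dirac_set_def m_def)
  show thesis
  proof (rule that)
    show "(\<lambda>y. tan (m 1 y)) \<in> borel_measurable borel"
      unfolding tan_def by measurable
    show "dirac_set K \<in> sets borel"
      unfolding D by measurable
    show "K y = return borel (tan (m 1 y))" if "y \<in> dirac_set K" for y
      using that iff(2) by (auto simp: dirac_set_def m_def)
  qed
qed

theorem proposition2p1:
  fixes P :: "(real \<times> 'b::{banach, second_countable_topology}) measure"
    and KX :: "real \<Rightarrow> 'b measure"
    and KY :: "'b \<Rightarrow> real measure"
  assumes "prob_space P"
    and "sets P = sets borel"
    and "prob_kernel KX"
    and "prob_kernel KY"
    and "disintegrates_along_fst P KX"
    and "disintegrates_along_snd P KY"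
    and "condition_D (first_marginal P) KX KY"
  shows "property_R_plus (first_marginal P) KX"
  unfolding property_R_plus_def
proof (intro allI impI)
  let ?\<mu> = "first_marginal P" and ?D = "dirac_set KY"
  fix f :: "real \<Rightarrow> real"
  assume f: "integrable ?\<mu> f" "AE x in ?\<mu>. 0 \<le> f x"
  have sets_\<mu>: "sets ?\<mu> = sets borel"
    by (simp add: first_marginal_def)
  have [measurable]: "f \<in> borel_measurable borel"
    using borel_measurable_integrable[OF f(1)] by (simp add: measurable_cong_sets[OF sets_\<mu> refl])
  note KX = prob_kernelD[OF assms(3)]
  obtain \<phi> where [measurable]: "\<phi> \<in> borel_measurable borel" "?D \<in> sets borel"
    and \<phi>: "\<And>y. y \<in> ?D \<Longrightarrow> KY y = return borel (\<phi> y)"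
    using dirac_set_atom_measurable[OF assms(4)] by blast
  define p where "p x = measure (KX x) ?D" for x
  have [measurable]: "p \<in> borel_measurable borel"
    unfolding p_def by (rule measurable_compose[OF KX(3) measurable_measure_subprob_algebra]) measurable
  \<comment> \<open>As \<open>f\<close> is nonnegative only almost everywhere, \<open>max 0\<close>
    makes \<open>g\<close> nonnegative at every point. Where \<open>p\<close> vanishes, division by
    zero gives the harmless value 0.\<close>
  define g where "g y = indicator ?D y * (max 0 (f (\<phi> y)) / p (\<phi> y))" for y
  \<comment> \<open>The exceptional set: points over \<open>?D\<close> off the graph of
    \<open>\<phi>\<close>. Its slices at fixed \<open>y\<close> are \<open>KY y\<close>-null, so
    \<open>A\<close> is \<open>P\<close>-null, and then so are almost all its slices at fixed
    \<open>x\<close>.\<close>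
  define A where "A = {z :: real \<times> 'b. snd z \<in> ?D \<and> \<phi> (snd z) \<noteq> fst z}"
  have "Measurable.pred (borel \<Otimes>\<^sub>M borel) (\<lambda>z :: real \<times> 'b. snd z \<in> ?D \<and> \<phi> (snd z) \<noteq> fst z)"
    by measurable
  then have A: "A \<in> sets borel"
    unfolding A_def borel_prod by (simp add: pred_def)
  have "emeasure (KY y) {x. (x, y) \<in> A} = 0" for y
  proof (cases "y \<in> ?D")
    case True
    have "{x. (x, y) \<in> A} = - {\<phi> y}"
      using True by (auto simp: A_def)
    then show ?thesis
      by (simp add: \<phi>[OF True])
  qed (simp add: A_def)
  then have "emeasure P A = 0"
    using assms(6) A by (simp add: disintegrates_along_snd_def)
  then have "(\<integral>\<^sup>+x. emeasure (KX x) {y. (x, y) \<in> A} \<partial>?\<mu>) = 0"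
    using assms(5) A by (simp add: disintegrates_along_fst_def)
  moreover have "(\<lambda>x. emeasure (KX x) {y. (x, y) \<in> A}) \<in> borel_measurable ?\<mu>"
    unfolding measurable_cong_sets[OF sets_\<mu> refl]
  proof (rule emeasure_measurable_subprob_algebra2[OF _ KX(3)])
    have "(SIGMA x:space borel. {y. (x, y) \<in> A}) = A"
      by auto
    then show "(SIGMA x:space borel. {y. (x, y) \<in> A}) \<in> sets (borel \<Otimes>\<^sub>M borel)"
      unfolding borel_prod using A by simp
  qed
  ultimately have null: "AE x in ?\<mu>. emeasure (KX x) {y. (x, y) \<in> A} = 0"
    by (simp add: nn_integral_0_iff_AE)
  have "AE x in ?\<mu>. ennreal (f x) = (\<integral>\<^sup>+y. ennreal (g y) \<partial>KX x)"
    using null f(2) assms(7)[unfolded condition_D_def]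
  proof eventually_elim
    fix x
    assume x: "emeasure (KX x) {y. (x, y) \<in> A} = 0" "0 \<le> f x" "0 < emeasure (KX x) ?D"
    interpret prob_space "KX x" by (rule KX(1))
    have p: "emeasure (KX x) ?D = ennreal (p x)"
      by (simp add: p_def emeasure_eq_measure)
    \<comment> \<open>Condition D enters here: a positive \<open>p x\<close> can be cancelled at the
      end.\<close>
    then have "0 < p x"
      using x(3) by simp
    have "{y. (x, y) \<in> A} \<in> sets (KX x)"
      unfolding A_def KX(2) by simp
    then have "AE y in KX x. (x, y) \<notin> A"
      using x(1) by (intro AE_I'[of "{y. (x, y) \<in> A}"]) (auto simp: null_sets_def)
    \<comment> \<open>Off the slice of \<open>A\<close>, each \<open>y\<close> in \<open>?D\<close>
      has \<open>\<phi> y = x\<close>, so \<open>g\<close> takes the single value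
      \<open>f x / p x\<close> on \<open>?D\<close>; the \<open>max\<close> drops out because
      \<open>0 \<le> f x\<close>.\<close>
    then have "(\<integral>\<^sup>+y. ennreal (g y) \<partial>KX x) = (\<integral>\<^sup>+y. ennreal (f x / p x) * indicator ?D y \<partial>KX x)"
      by (intro nn_integral_cong_AE, eventually_elim)
         (use x(2) in \<open>auto simp: A_def g_def split: split_indicator\<close>)
    also have "\<dots> = ennreal (f x / p x) * ennreal (p x)"
      unfolding p[symmetric] by (intro nn_integral_cmult_indicator) (simp add: KX(2))
    also have "\<dots> = ennreal (f x)"
      using \<open>0 < p x\<close> x(2) by (simp flip: ennreal_mult)
    finally show "ennreal (f x) = (\<integral>\<^sup>+y. ennreal (g y) \<partial>KX x)" ..
  qed
  moreover have "g \<in> borel_measurable borel"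
    unfolding g_def by measurable
  moreover have "\<forall>y. 0 \<le> g y"
    by (simp add: g_def p_def)
  ultimately show "\<exists>g :: 'b \<Rightarrow> real. g \<in> borel_measurable borel \<and> (\<forall>y. 0 \<le> g y) \<and>
        (AE x in ?\<mu>. ennreal (f x) = (\<integral>\<^sup>+y. ennreal (g y) \<partial>KX x))"
    by blast
qed

end
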